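(* Let $k$ be a field and let ${}_1k_1^2$ be the Poisson algebra with basis $\{y_1,y_2\}$ and $y_1y_1=y_1$, $y_1y_2=y_2$, $[y_1,y_2]=y_2$. Any $3$-dimensional co-flag Poisson algebra over ${}_1k_1^2$ is cohomologous to one of the following Poisson algebras with basis $\{e_1,e_2,e_3\}$: ${}_1k_1^3$: $e_1\star e_1=e_1$, $e_1\star e_2=e_2$, $\{e_1,e_2\}=e_2$; ${}_1\overline{k}_1^3$: $e_1\star e_1=e_1$, $e_1\star e_2=e_2$, $e_1\star e_3=e_3\star e_1=e_3$, $\{e_1,e_2\}=e_2$; ${}_{\nu}k_1^3$: $e_1\star e_1=e_1$, $e_1\star e_2=e_2$, $e_1\star e_3=e_3$, $\{e_1,e_3\}=e_3$, $\{e_1,e_2\}=e_2+\nu e_3$, where $\nu\in k$; ${}_{\omega}\widetilde{k}_1^3$: $e_1\star e_1=e_1$, $e_1\star e_2=e_2$, $e_1\star e_3=e_3$, $\{e_1,e_3\}=\omega e_3$, $\{e_1,e_2\}=e_2$, where $\omega\in k\setminus\{1\}$; ${}_{\tau}\overline{k}_1^3$: $e_1\star e_1=e_1$, $e_1\star e_2=e_2$, $e_3\star e_1=e_3$, $\{e_1,e_3\}=\tau e_3$, $\{e_1,e_2\}=e_2$, where $\tau\in k$; $k_{1,u}^3$: $e_1\star e_1=e_1$, $e_1\star e_2=e_2$, $e_3\star e_3=u e_3$, $\{e_1,e_2\}=e_2$, where $u\in k^*$. Furthermore, $$\mathcal{GPH}^2({}_1k_1^2,k)\cong\{*\}\sqcup\{*\}\sqcup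 k\sqcup(k\setminus\{1\})\sqcup k\sqcup k^*,$$ where $\{*\}$ denotes the singleton set.
   Context: $k^*=k\setminus\{0\}$; everything is over $k$. Algebras are associative, not necessarily commutative or unital. A Poisson algebra is a vector space $P$ with an associative multiplication $pq$ and a Lie bracket $[-,-]$ such that $[pq,r]=[p,r]q+p[q,r]$ for all $p,q,r\in P$. When a Poisson algebra is given on a basis only the non-zero products and brackets are listed (up to antisymmetry of the bracket). A Poisson algebra $Q$ is a co-flag Poisson algebra over a Poisson algebra $P$ if there is a finite chain of epimorphisms of Poisson algebras $P_n:=Q\xrightarrow{\pi_n}P_{n-1}\to\cdots\to P_1\xrightarrow{\pi_1}P_0:=P\to0$ with $n\ge 1$ and $\dim_k\mathrm{Ker}(\pi_i)=1$ for all $i$. Thus a 3-dimensional co-flag Poisson algebra over $P={}_1k_1^2$ is a 3-dimensional Poisson algebra $Q$ with an epimorphism of Poisson algebras $\pi:Q\to P$ having 1-dimensional kernel, which is identified linearly with $k e_3$. "Cohomologous to $R$", for $R$ in the list regarded with the projection $R\to P$, $e_1\mapsto y_1$, $e_2\mapsto y_2$, $e_3\mapsto0$, means that there is an isomorphism of Poisson algebras $Q\to R$ compatible with the identification of the kernels (it stabilizes the kernel) and with the projections onto $P$ (it co-stabilizes $P$). A crossed system of $P$ by a vector space $V$ is a system $(\rightharpoonup,\triangleleft,\vartheta,\cdot_V,\triangleright,f,[-,-]_V)$ of bilinear maps $\rightharpoonup:P\times V\to V$, $\triangleleft:V\times P\to V$, $\vartheta:P\times P\to V$, $\cdot_V:V\times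 V\to V$, $\triangleright:P\times V\to V$, $f:P\times P\to V$, $[-,-]_V:V\times V\to V$ such that $P\times V$ with $(p,x)\star(q,y):=(pq,\ \vartheta(p,q)+p\rightharpoonup y+x\triangleleft q+x\cdot_V y)$ and $\{(p,x),(q,y)\}:=([p,q],\ f(p,q)+p\triangleright y-q\triangleright x+[x,y]_V)$ is a Poisson algebra. Two crossed systems (the second with primes) are cohomologous ($\approx$) if $\cdot_V=\cdot_V'$, $[-,-]_V=[-,-]_V'$ and there is a linear map $r:P\to V$ with, for all $p,q\in P$, $x\in V$: $p\rightharpoonup x=p\rightharpoonup' x+r(p)\cdot_V x$; $x\triangleleft p=x\triangleleft' p+x\cdot_V r(p)$; $\vartheta(p,q)=\vartheta'(p,q)+p\rightharpoonup' r(q)+r(p)\triangleleft' q-r(pq)+r(p)\cdot_V r(q)$; $p\triangleright x=p\triangleright' x+[r(p),x]_V$; $f(p,q)=f'(p,q)+p\triangleright' r(q)-q\triangleright' r(p)+[r(p),r(q)]_V-r([p,q])$. $\mathcal{GPH}^2(P,V)$ is the set of all crossed systems of $P$ by $V$ modulo $\approx$; here $V=k$ as a one-dimensional vector space. The symbol $\cong$ between sets denotes a bijection and $\sqcup$ disjoint union. *)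

theory Defs
  imports "HOL-Analysis.Analysis"
begin

section \<open>Poisson algebras over a field\<close>

text \<open>The ground field is the type \<open>'k\<close>; the underlying vector space is the whole type \<open>'a\<close>
  with the scalar multiplication stored in the record. Multiplication is associative, but neither
  commutativity nor a unit is required. The bracket is alternating, which is the correct notion of
  a Lie bracket in every characteristic.\<close>

record ('k, 'a) palg =
  scl :: "'k \<Rightarrow> 'a \<Rightarrow> 'a"
  mul :: "'a \<Rightarrow> 'a \<Rightarrow> 'a"
  brk :: "'a \<Rightarrow> 'a \<Rightarrow> 'a"

definition bilin ::
  "('k::field \<Rightarrow> 'a::ab_group_add \<Rightarrow> 'a) \<Rightarrow> ('k \<Rightarrow> 'b::ab_group_add \<Rightarrow> 'b) \<Rightarrow>
   ('k \<Rightarrow> 'c::ab_group_add \<Rightarrow> 'c) \<Rightarrow> ('a \<Rightarrow> 'b \<Rightarrow> 'c) \<Rightarrow> bool" where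
  "bilin sA sB sC h \<longleftrightarrow>
     (\<forall>a. Vector_Spaces.linear sB sC (\<lambda>b. h a b)) \<and>
     (\<forall>b. Vector_Spaces.linear sA sC (\<lambda>a. h a b))"

locale poisson_algebra = vector_space "scl A"
  for A :: "('k::field, 'a::ab_group_add) palg" +
  assumes mul_bilin: "bilin (scl A) (scl A) (scl A) (mul A)"
    and mul_assoc: "mul A (mul A x y) z = mul A x (mul A y z)"
    and brk_bilin: "bilin (scl A) (scl A) (scl A) (brk A)"
    and brk_self: "brk A x x = 0"
    and jacobi: "brk A x (brk A y z) + brk A y (brk A z x) + brk A z (brk A x y) = 0"
    and leibniz: "brk A (mul A x y) z = mul A (brk A x z) y + mul A x (brk A y z)"

definition poisson_hom ::
  "('k::field, 'a::ab_group_add) palg \<Rightarrow> ('k, 'b::ab_group_add) palg \<Rightarrow> ('a \<Rightarrow> 'b) \<Rightarrow> bool" where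
  "poisson_hom A B h \<longleftrightarrow>
     poisson_algebra A \<and> poisson_algebra B \<and>
     Vector_Spaces.linear (scl A) (scl B) h \<and>
     (\<forall>x y. h (mul A x y) = mul B (h x) (h y)) \<and>
     (\<forall>x y. h (brk A x y) = brk B (h x) (h y))"


section \<open>One-dimensional co-flag steps\<close>

text \<open>A co-flag algebra over \<open>P\<close> is obtained by a chain of such steps, each raising the dimension by
  one. A 3-dimensional co-flag algebra over a 2-dimensional \<open>P\<close> therefore has a chain consisting of
  exactly one step.\<close>

definition coflag_step ::
  "('k::field, 'q::ab_group_add) palg \<Rightarrow> ('k, 'p::ab_group_add) palg \<Rightarrow> ('q \<Rightarrow> 'p) \<Rightarrow> bool" where
  "coflag_step Q P \<pi> \<longleftrightarrow>
     poisson_hom Q P \<pi> \<and> surj \<pi> \<and> vector_space.dim (scl Q) {x. \<pi> x = 0} = 1"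

text \<open>A linear identification of \<open>Ker \<pi>\<close> with the one-dimensional space \<open>k\<close>.\<close>

definition kernel_ident ::
  "('k::field, 'q::ab_group_add) palg \<Rightarrow> ('q \<Rightarrow> 'p::ab_group_add) \<Rightarrow> ('k \<Rightarrow> 'q) \<Rightarrow> bool" where
  "kernel_ident Q \<pi> \<iota> \<longleftrightarrow>
     Vector_Spaces.linear (*) (scl Q) \<iota> \<and> inj \<iota> \<and> range \<iota> = {x. \<pi> x = 0}"

text \<open>An isomorphism \<open>\<phi>\<close> of Poisson algebras that stabilizes the kernel
  (\<open>\<phi> \<circ> \<iota>1 = \<iota>2\<close>) and co-stabilizes the base (\<open>\<pi>2 \<circ> \<phi> = \<pi>1\<close>).\<close>

definition ext_cohomologous ::
  "('k::field, 'q::ab_group_add) palg \<Rightarrow> ('q \<Rightarrow> 'p) \<Rightarrow> ('k \<Rightarrow> 'q) \<Rightarrow>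
   ('k, 'r::ab_group_add) palg \<Rightarrow> ('r \<Rightarrow> 'p) \<Rightarrow> ('k \<Rightarrow> 'r) \<Rightarrow> bool" where
  "ext_cohomologous Q \<pi>1 \<iota>1 R \<pi>2 \<iota>2 \<longleftrightarrow>
     (\<exists>\<phi>. poisson_hom Q R \<phi> \<and> bij \<phi> \<and> \<phi> \<circ> \<iota>1 = \<iota>2 \<and> \<pi>2 \<circ> \<phi> = \<pi>1)"


section \<open>Poisson algebras given by tables on a basis\<close>

definition bas :: "'n \<Rightarrow> 'k::field ^ 'n" where
  "bas i = axis i 1"

text \<open>An entry \<open>(i, j, v)\<close> of the first list says that \<open>bas i \<star> bas j = v\<close>, an entry of the second
  list that \<open>{bas i, bas j} = v = - {bas j, bas i}\<close>; products and brackets of basis vectors that are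
  not listed (in the case of brackets: in neither order) are zero. The lists must not contain
  repeated positions.\<close>

definition table_alg ::
  "('n::finite \<times> 'n \<times> ('k::field ^ 'n)) list \<Rightarrow> ('n \<times> 'n \<times> ('k ^ 'n)) list \<Rightarrow> ('k, 'k ^ 'n) palg" where
  "table_alg ms bs =
     \<lparr> scl = (*s),
       mul = (\<lambda>x y. \<Sum>(i, j, v) \<leftarrow> ms. (x $ i * y $ j) *s v),
       brk = (\<lambda>x y. \<Sum>(i, j, v) \<leftarrow> bs. (x $ i * y $ j - x $ j * y $ i) *s v) \<rparr>"

definition P12 :: "('k::field, 'k ^ 2) palg" where
  "P12 = table_alg [(1, 1, bas 1), (1, 2, bas 2)] [(1, 2, bas 2)]"

definition k13 :: "('k::field, 'k ^ 3) palg" where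
  "k13 = table_alg
     [(1, 1, bas 1), (1, 2, bas 2)]
     [(1, 2, bas 2)]"

definition k13_bar :: "('k::field, 'k ^ 3) palg" where
  "k13_bar = table_alg
     [(1, 1, bas 1), (1, 2, bas 2), (1, 3, bas 3), (3, 1, bas 3)]
     [(1, 2, bas 2)]"

definition k13_nu :: "'k::field \<Rightarrow> ('k, 'k ^ 3) palg" where
  "k13_nu \<nu> = table_alg
     [(1, 1, bas 1), (1, 2, bas 2), (1, 3, bas 3)]
     [(1, 3, bas 3), (1, 2, bas 2 + \<nu> *s bas 3)]"

definition k13_omega :: "'k::field \<Rightarrow> ('k, 'k ^ 3) palg" where
  "k13_omega \<omega> = table_alg
     [(1, 1, bas 1), (1, 2, bas 2), (1, 3, bas 3)]
     [(1, 3, \<omega> *s bas 3), (1, 2, bas 2)]"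

definition k13_tau :: "'k::field \<Rightarrow> ('k, 'k ^ 3) palg" where
  "k13_tau \<tau> = table_alg
     [(1, 1, bas 1), (1, 2, bas 2), (3, 1, bas 3)]
     [(1, 3, \<tau> *s bas 3), (1, 2, bas 2)]"

definition k13_u :: "'k::field \<Rightarrow> ('k, 'k ^ 3) palg" where
  "k13_u u = table_alg
     [(1, 1, bas 1), (1, 2, bas 2), (3, 3, u *s bas 3)]
     [(1, 2, bas 2)]"

text \<open>All of these are Poisson algebras, for every value of the parameters.\<close>

lemma table_poisson:
  fixes ms bs :: "('n::finite \<times> 'n \<times> ('k::field ^ 'n)) list"
  assumes "\<And>x y z. mul (table_alg ms bs) (mul (table_alg ms bs) x y) z = mul (table_alg ms bs) x (mul (table_alg ms bs) y z)"
  "\<And>x y z. brk (table_alg ms bs) x (brk (table_alg ms bs) y z) + brk (table_alg ms bs) y (brk (table_alg ms bs) z x) + brk (table_alg ms bs) z (brk (table_alg ms bs) x y) = 0"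
  "\<And>x y z. brk (table_alg ms bs) (mul (table_alg ms bs) x y) z = mul (table_alg ms bs) (brk (table_alg ms bs) x z) y + mul (table_alg ms bs) x (brk (table_alg ms bs) y z)"
  shows "poisson_algebra (table_alg ms bs)"
proof -
  have v: "vector_space (scl (table_alg ms bs))"
    by (simp add: table_alg_def vec.vector_space_axioms)
  have lin: "Vector_Spaces.linear (*s) (*s) h" if "\<And>x y. h (x+y) = h x + h y" "\<And>c x. h (c *s x) = c *s h x" for h :: "'k^'n \<Rightarrow> 'k^'n"
    unfolding Vector_Spaces.linear_def module_hom_def module_hom_axioms_def
    using that vec.vector_space_axioms vec.module_axioms by auto
  have a: "bilin (*s) (*s) (*s) (mul (table_alg ms bs))" unfolding bilin_def
    apply (intro conjI allI lin; simp add: table_alg_def; induction ms)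
    by (auto simp: vec_eq_iff algebra_simps)
  have b: "bilin (*s) (*s) (*s) (brk (table_alg ms bs))" unfolding bilin_def
    apply (intro conjI allI lin; simp add: table_alg_def; induction bs)
    by (auto simp: vec_eq_iff algebra_simps)
  have c: "brk (table_alg ms bs) x x = 0" for x
    apply (simp add: table_alg_def; induction bs) by (auto simp: vec_eq_iff algebra_simps)
  show ?thesis unfolding poisson_algebra_def poisson_algebra_axioms_def 
    using v a b c assms by (simp add: table_alg_def)
qed

lemma poisson_P12: "poisson_algebra P12" unfolding P12_def k13_def k13_bar_def k13_nu_def k13_omega_def k13_tau_def k13_u_def
  by (rule table_poisson; simp add: table_alg_def bas_def axis_def vec_eq_iff forall_2 algebra_simps)

lemma poisson_k13:
  "poisson_algebra k13" "poisson_algebra k13_bar" "poisson_algebra (k13_nu \<nu>)" "poisson_algebra (k13_omega \<omega>)"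
 "poisson_algebra (k13_tau \<tau>)" "poisson_algebra (k13_u u)" unfolding P12_def k13_def k13_bar_def k13_nu_def k13_omega_def k13_tau_def k13_u_def
  by (rule table_poisson; simp add: table_alg_def bas_def axis_def vec_eq_iff forall_3 algebra_simps)+

text \<open>The projection \<open>e1 \<mapsto> y1\<close>, \<open>e2 \<mapsto> y2\<close>, \<open>e3 \<mapsto> 0\<close>.\<close>

definition proj32 :: "'k::field ^ 3 \<Rightarrow> 'k ^ 2" where
  "proj32 x = x $ 1 *s bas 1 + x $ 2 *s bas 2"

definition cohomologous_to ::
  "('k::field, 'q::ab_group_add) palg \<Rightarrow> ('q \<Rightarrow> 'k ^ 2) \<Rightarrow> ('k \<Rightarrow> 'q) \<Rightarrow> ('k, 'k ^ 3) palg \<Rightarrow> bool"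
  where
  "cohomologous_to Q \<pi> \<iota> R \<longleftrightarrow> ext_cohomologous Q \<pi> \<iota> R proj32 (\<lambda>c. c *s bas 3)"


section \<open>Crossed systems and \<open>GPH2\<close>\<close>

text \<open>Fields, in order: \<open>\<rightharpoonup>\<close>, \<open>\<triangleleft>\<close>, \<open>\<vartheta>\<close>, \<open>\<cdot>\<^sub>V\<close>, \<open>\<triangleright>\<close>, \<open>f\<close>, \<open>[-,-]\<^sub>V\<close>.\<close>

record ('p, 'v) crossed =
  lact :: "'p \<Rightarrow> 'v \<Rightarrow> 'v"
  ract :: "'v \<Rightarrow> 'p \<Rightarrow> 'v"
  theta :: "'p \<Rightarrow> 'p \<Rightarrow> 'v"
  vmul :: "'v \<Rightarrow> 'v \<Rightarrow> 'v"
  pact :: "'p \<Rightarrow> 'v \<Rightarrow> 'v"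
  cocyc :: "'p \<Rightarrow> 'p \<Rightarrow> 'v"
  vbrk :: "'v \<Rightarrow> 'v \<Rightarrow> 'v"

definition crossed_product ::
  "('k::field, 'p::ab_group_add) palg \<Rightarrow> ('k \<Rightarrow> 'v::ab_group_add \<Rightarrow> 'v) \<Rightarrow> ('p, 'v) crossed \<Rightarrow>
   ('k, 'p \<times> 'v) palg" where
  "crossed_product P sV C =
     \<lparr> scl = module_prod.scale (scl P) sV,
       mul = (\<lambda>(p, x) (q, y).
         (mul P p q, theta C p q + lact C p y + ract C x q + vmul C x y)),
       brk = (\<lambda>(p, x) (q, y).
         (brk P p q, cocyc C p q + pact C p y - pact C q x + vbrk C x y)) \<rparr>"

definition crossed_systems ::
  "('k::field, 'p::ab_group_add) palg \<Rightarrow> ('k \<Rightarrow> 'v::ab_group_add \<Rightarrow> 'v) \<Rightarrow> ('p, 'v) crossed set"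
  where
  "crossed_systems P sV =
     {C. bilin (scl P) sV sV (lact C) \<and>
         bilin sV (scl P) sV (ract C) \<and>
         bilin (scl P) (scl P) sV (theta C) \<and>
         bilin sV sV sV (vmul C) \<and>
         bilin (scl P) sV sV (pact C) \<and>
         bilin (scl P) (scl P) sV (cocyc C) \<and>
         bilin sV sV sV (vbrk C) \<and>
         poisson_algebra (crossed_product P sV C)}"

definition crossed_cohomologous ::
  "('k::field, 'p::ab_group_add) palg \<Rightarrow> ('k \<Rightarrow> 'v::ab_group_add \<Rightarrow> 'v) \<Rightarrow>
   ('p, 'v) crossed \<Rightarrow> ('p, 'v) crossed \<Rightarrow> bool" where
  "crossed_cohomologous P sV C D \<longleftrightarrow>
     vmul C = vmul D \<and> vbrk C = vbrk D \<and>
     (\<exists>r. Vector_Spaces.linear (scl P) sV r \<and>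
        (\<forall>p x. lact C p x = lact D p x + vmul D (r p) x) \<and>
        (\<forall>p x. ract C x p = ract D x p + vmul D x (r p)) \<and>
        (\<forall>p q. theta C p q =
           theta D p q + lact D p (r q) + ract D (r p) q - r (mul P p q) + vmul D (r p) (r q)) \<and>
        (\<forall>p x. pact C p x = pact D p x + vbrk D (r p) x) \<and>
        (\<forall>p q. cocyc C p q =
           cocyc D p q + pact D p (r q) - pact D q (r p) + vbrk D (r p) (r q) - r (brk P p q)))"

definition GPH2 ::
  "('k::field, 'p::ab_group_add) palg \<Rightarrow> ('k \<Rightarrow> 'v::ab_group_add \<Rightarrow> 'v) \<Rightarrow> ('p, 'v) crossed set set"
  where
  "GPH2 P sV = crossed_systems P sV //
     {(C, D). C \<in> crossed_systems P sV \<and> D \<in> crossed_systems P sV \<and> crossed_cohomologous P sV C D}"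

end

theory Submission
  imports Defs
begin

text \<open>
  An extension of a Poisson algebra \<open>P\<close> by a one-dimensional kernel is, after the choice of a linear section, a
  crossed product of \<open>P\<close> with \<open>k\<close> (\<open>extension_is_crossed_product\<close>). Changing the section by a linear map
  \<open>r\<close> from \<open>P\<close> to \<open>k\<close> gives a cohomologous crossed system, and cohomologous systems have equivalent crossed products
  (\<open>ext_cohomologous_crossed_product\<close>). Both halves of the theorem thus reduce to one computation: to
  find exactly one representative in each cohomology class of crossed systems of \<open>P12\<close> by \<open>k\<close>.

  A class is first divided according to the product on the kernel, which is an invariant. If it is nonzero,
  say \<open>x \<cdot> y = u x y\<close>, then the kernel is unital and the extension splits as a direct product
  (\<open>crossed_cohomologous_split\<close>); this is the family indexed by \<open>u\<close>. If it is zero, the left and right actions of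
  \<open>P12\<close> on the kernel are invariants, and each is a character of \<open>P12\<close>, so it is determined by a value
  in \<open>{0, 1}\<close> at \<open>y1\<close>. The four combinations give the remaining families
  (\<open>crossed_cohomologous_square_zero\<close>). The bracket action of \<open>y1\<close> is a free scalar \<open>g\<close> when just one of the two
  actions is nonzero and is zero otherwise. The associative cocycle is always a coboundary. A nontrivial
  bracket cocycle can occur only if just the left action is nonzero and \<open>g = 1\<close>: the value of the cocycle at
  \<open>(y1, y2)\<close> can be changed by any multiple of \<open>g - 1\<close>. This is why the case of a left action alone contributes
  one family indexed by \<open>\<nu>\<close> (with \<open>g = 1\<close>) and one indexed by \<open>\<omega> = g \<noteq> 1\<close>.

  The same quantities distinguish the representatives (\<open>normal_system_invariants\<close>), so the parameter
  set is in bijection with the set of cohomology classes (\<open>GPH2_bij\<close>). Each representative has one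
  of the six listed algebras as its crossed product (\<open>normal_form_product\<close>).
\<close>

section \<open>Linear and bilinear maps\<close>

lemma linear_between_iff:
  "Vector_Spaces.linear s1 s2 f \<longleftrightarrow>
     vector_space s1 \<and> vector_space s2 \<and>
     (\<forall>x y. f (x + y) = f x + f y) \<and> (\<forall>c x. f (s1 c x) = s2 c (f x))"
  unfolding module_hom_iff_linear[symmetric] module_hom_iff module_iff_vector_space by blast

lemma bilin_iff:
  "bilin sA sB sC h \<longleftrightarrow>
     vector_space sA \<and> vector_space sB \<and> vector_space sC \<and>
     (\<forall>a b b'. h a (b + b') = h a b + h a b') \<and> (\<forall>a c b. h a (sB c b) = sC c (h a b)) \<and>
     (\<forall>a a' b. h (a + a') b = h a b + h a' b) \<and> (\<forall>c a b. h (sA c a) b = sC c (h a b))"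
  unfolding bilin_def linear_between_iff by auto

lemma bilin_compose:
  assumes "bilin sA sB sC h" "Vector_Spaces.linear sA' sA f" "Vector_Spaces.linear sB' sB g"
    "Vector_Spaces.linear sC sC' k"
  shows "bilin sA' sB' sC' (\<lambda>x y. k (h (f x) (g y)))"
  using assms unfolding bilin_iff linear_between_iff by simp

lemma bilin_minus:
  assumes "bilin sA sB sC h"
  shows "h (- a) b = - h a b" "h a (- b) = - h a b"
proof -
  interpret l: Vector_Spaces.linear sA sC "\<lambda>a. h a b" using assms unfolding bilin_def by blast
  interpret r: Vector_Spaces.linear sB sC "h a" using assms unfolding bilin_def by blast
  show "h (- a) b = - h a b" by (rule l.neg)
  show "h a (- b) = - h a b" by (rule r.neg)
qed

lemma bilin_zero:
  assumes "bilin sA sB sC h"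
  shows "h 0 b = 0" "h a 0 = 0"
proof -
  interpret l: Vector_Spaces.linear sA sC "\<lambda>a. h a b" using assms unfolding bilin_def by blast
  interpret r: Vector_Spaces.linear sB sC "h a" using assms unfolding bilin_def by blast
  show "h 0 b = 0" by (rule l.zero)
  show "h a 0 = 0" by (rule r.zero)
qed

section \<open>Homomorphisms and equivalence of extensions\<close>

lemma (in poisson_algebra) brk_anti: "brk A x y = - brk A y x"
proof -
  have "brk A (x + y) (x + y) = brk A x x + brk A x y + (brk A y x + brk A y y)"
    using brk_bilin unfolding bilin_iff by (simp add: algebra_simps)
  then show ?thesis by (simp add: brk_self eq_neg_iff_add_eq_0)
qed

text \<open>Every Poisson axiom is an identity, hence passes to a surjective image. This is how all crossed
  products below are seen to be Poisson algebras: each is hit by a known Poisson algebra.\<close>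

lemma poisson_hom_surj_image:
  assumes A: "poisson_algebra A" and lin: "Vector_Spaces.linear (scl A) (scl B) h" and h: "surj h"
    and mul: "\<And>x y. h (mul A x y) = mul B (h x) (h y)"
    and brk: "\<And>x y. h (brk A x y) = brk B (h x) (h y)"
  shows "poisson_hom A B h"
proof -
  interpret A: poisson_algebra A by (rule A)
  have all: "(\<forall>b. P b) \<longleftrightarrow> (\<forall>x. P (h x))" for P using h by (metis surjD)
  have add: "h x + h y = h (x + y)" and scl: "scl B c (h x) = h (scl A c x)"
    and vs: "vector_space (scl A)" "vector_space (scl B)" for x y c
    using lin unfolding linear_between_iff by simp_all
  have zero: "h 0 = 0" using add[of 0 0] by simp
  have pull: "mul B (h x) (h y) = h (mul A x y)" "brk B (h x) (h y) = h (brk A x y)" for x y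
    using mul brk by simp_all
  have "bilin (scl B) (scl B) (scl B) (mul B)" "bilin (scl B) (scl B) (scl B) (brk B)"
    using A.mul_bilin A.brk_bilin vs unfolding bilin_iff all by (simp_all add: add scl pull)
  moreover have "\<forall>x y z. mul B (mul B x y) z = mul B x (mul B y z)"
    unfolding all by (simp add: pull A.mul_assoc)
  moreover have "\<forall>x. brk B x x = 0" unfolding all by (simp add: pull A.brk_self zero)
  moreover have "\<forall>x y z. brk B x (brk B y z) + brk B y (brk B z x) + brk B z (brk B x y) = 0"
    unfolding all by (simp add: pull add A.jacobi zero)
  moreover have "\<forall>x y z. brk B (mul B x y) z = mul B (brk B x z) y + mul B x (brk B y z)"
    unfolding all by (simp add: pull add A.leibniz)
  ultimately have "poisson_algebra B"
    using vs unfolding poisson_algebra_def poisson_algebra_axioms_def by blast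
  then show ?thesis unfolding poisson_hom_def using A lin mul brk by blast
qed

lemma ext_cohomologous_sym:
  assumes "ext_cohomologous Q \<pi>1 \<iota>1 R \<pi>2 \<iota>2"
  shows "ext_cohomologous R \<pi>2 \<iota>2 Q \<pi>1 \<iota>1"
proof -
  obtain \<phi> where hom: "poisson_hom Q R \<phi>" and bij: "bij \<phi>" and st: "\<phi> \<circ> \<iota>1 = \<iota>2" "\<pi>2 \<circ> \<phi> = \<pi>1"
    using assms unfolding ext_cohomologous_def by blast
  have inv: "inv \<phi> (\<phi> x) = x" "\<phi> (inv \<phi> y) = y" for x y
    using bij by (simp_all add: bij_is_inj bij_is_surj surj_f_inv_f)
  have "poisson_hom R Q (inv \<phi>)"
    using hom unfolding poisson_hom_def linear_between_iff by (metis inv)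
  moreover have "inv \<phi> \<circ> \<iota>2 = \<iota>1" "\<pi>1 \<circ> inv \<phi> = \<pi>2"
    using inv by (simp_all add: fun_eq_iff flip: st)
  ultimately show ?thesis
    unfolding ext_cohomologous_def using bij_imp_bij_inv[OF bij] by blast
qed

lemma ext_cohomologous_trans:
  assumes "ext_cohomologous Q \<pi>1 \<iota>1 R \<pi>2 \<iota>2" "ext_cohomologous R \<pi>2 \<iota>2 S \<pi>3 \<iota>3"
  shows "ext_cohomologous Q \<pi>1 \<iota>1 S \<pi>3 \<iota>3"
proof -
  obtain \<phi> \<psi> where
    \<phi>: "poisson_hom Q R \<phi>" "bij \<phi>" "\<phi> \<circ> \<iota>1 = \<iota>2" "\<pi>2 \<circ> \<phi> = \<pi>1" and
    \<psi>: "poisson_hom R S \<psi>" "bij \<psi>" "\<psi> \<circ> \<iota>2 = \<iota>3" "\<pi>3 \<circ> \<psi> = \<pi>2"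
    using assms unfolding ext_cohomologous_def by blast
  have "poisson_hom Q S (\<psi> \<circ> \<phi>)"
    using \<phi>(1) \<psi>(1) unfolding poisson_hom_def linear_between_iff by simp
  then show ?thesis
    unfolding ext_cohomologous_def
    using bij_comp[OF \<phi>(2) \<psi>(2)] \<phi>(3,4) \<psi>(3,4) by (metis comp_assoc)
qed

section \<open>Crossed products and extensions\<close>

lemma scl_crossed_product:
  assumes "vector_space (scl P)" "vector_space sV"
  shows "scl (crossed_product P sV C) c v = (scl P c (fst v), sV c (snd v))"
    and "vector_space (scl (crossed_product P sV C))"
proof -
  interpret vector_space_prod "scl P" sV
    using assms by (simp add: vector_space_prod_def vector_space_pair_def)
  show "scl (crossed_product P sV C) c v = (scl P c (fst v), sV c (snd v))"
    by (simp add: crossed_product_def scale_def)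
  show "vector_space (scl (crossed_product P sV C))"
    by (simp add: crossed_product_def p.vector_space_axioms)
qed

text \<open>A linear section \<open>s\<close> of \<open>\<pi>\<close> gives a linear retraction \<open>\<kappa>\<close> of \<open>Q\<close> onto the kernel. Applying \<open>\<kappa>\<close> to the
  products and brackets of the two summands \<open>s P\<close> and \<open>\<iota> k\<close> defines a crossed system, and
  \<open>q \<mapsto> (\<pi> q, \<kappa> q)\<close> identifies \<open>Q\<close> with its crossed product.\<close>

lemma extension_is_crossed_product:
  fixes Q :: "('k::field, 'q::ab_group_add) palg" and P :: "('k, 'p::ab_group_add) palg"
  assumes hom: "poisson_hom Q P \<pi>" and surj: "surj \<pi>" and ker: "kernel_ident Q \<pi> \<iota>"
  obtains C where "C \<in> crossed_systems P (*)"
    and "ext_cohomologous Q \<pi> \<iota> (crossed_product P (*) C) fst (\<lambda>x. (0, x))"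
proof -
  have Q: "poisson_algebra Q" and P: "poisson_algebra P"
    and \<pi>_lin: "Vector_Spaces.linear (scl Q) (scl P) \<pi>"
    and \<pi>_mul: "\<And>x y. \<pi> (mul Q x y) = mul P (\<pi> x) (\<pi> y)"
    and \<pi>_brk: "\<And>x y. \<pi> (brk Q x y) = brk P (\<pi> x) (\<pi> y)"
    using hom unfolding poisson_hom_def by blast+
  have \<iota>_lin: "Vector_Spaces.linear (*) (scl Q) \<iota>" and \<iota>_inj: "inj \<iota>"
    and \<iota>_range: "range \<iota> = {x. \<pi> x = 0}"
    using ker unfolding kernel_ident_def by blast+
  interpret Q: poisson_algebra Q by (rule Q)
  interpret P: poisson_algebra P by (rule P)
  interpret \<pi>: Vector_Spaces.linear "scl Q" "scl P" \<pi> by (rule \<pi>_lin)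
  interpret \<iota>: Vector_Spaces.linear "(*)" "scl Q" \<iota> by (rule \<iota>_lin)
  obtain s where s_lin: "Vector_Spaces.linear (scl P) (scl Q) s" and s: "\<pi> (s p) = p" for p
    using vector_space_pair.linear_surjective_right_inverse[OF _ \<pi>_lin surj]
    by (metis P.vector_space_axioms Q.vector_space_axioms vector_space_pair.intro comp_apply id_apply)
  interpret s: Vector_Spaces.linear "scl P" "scl Q" s by (rule s_lin)
  define \<kappa> where "\<kappa> q = inv \<iota> (q - s (\<pi> q))" for q
  \<comment> \<open>The difference \<open>q - s (\<pi> q)\<close> lies in the kernel, which is the range of \<open>\<iota>\<close>.\<close>
  have split: "s (\<pi> q) + \<iota> (\<kappa> q) = q" for q
  proof -
    have "\<pi> (q - s (\<pi> q)) = 0" by (simp add: \<pi>.diff s)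
    then have "q - s (\<pi> q) \<in> range \<iota>" using \<iota>_range by blast
    then show ?thesis by (simp add: \<kappa>_def f_inv_into_f)
  qed
  have \<pi>\<iota>: "\<pi> (\<iota> x) = 0" for x using \<iota>_range by blast
  have \<kappa>_eq: "\<kappa> q = x" if "q = s (\<pi> q) + \<iota> x" for q x
    using that split[of q] \<iota>_inj by (metis add_left_cancel injD)
  have \<kappa>_add: "\<kappa> (a + b) = \<kappa> a + \<kappa> b" for a b
  proof (rule \<kappa>_eq)
    have "a + b = (s (\<pi> a) + \<iota> (\<kappa> a)) + (s (\<pi> b) + \<iota> (\<kappa> b))" by (simp only: split)
    then show "a + b = s (\<pi> (a + b)) + \<iota> (\<kappa> a + \<kappa> b)"
      unfolding \<pi>.add s.add \<iota>.add by (simp only: ac_simps)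
  qed
  have \<kappa>_scl: "\<kappa> (scl Q c a) = c * \<kappa> a" for c a
  proof (rule \<kappa>_eq)
    have "scl Q c a = scl Q c (s (\<pi> a) + \<iota> (\<kappa> a))" by (simp only: split)
    then show "scl Q c a = s (\<pi> (scl Q c a)) + \<iota> (c * \<kappa> a)"
      unfolding \<pi>.scale s.scale \<iota>.scale by (simp only: Q.scale_right_distrib)
  qed
  have \<kappa>_lin: "Vector_Spaces.linear (scl Q) (*) \<kappa>"
    unfolding linear_between_iff
    using \<kappa>_add \<kappa>_scl Q.vector_space_axioms vector_space_over_itself.vector_space_axioms by blast
  have \<kappa>\<iota>: "\<kappa> (\<iota> x) = x" for x by (rule \<kappa>_eq) (simp add: \<pi>\<iota>)
  define C where "C = \<lparr> lact = \<lambda>p x. \<kappa> (mul Q (s p) (\<iota> x)), ract = \<lambda>x p. \<kappa> (mul Q (\<iota> x) (s p)),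
     theta = \<lambda>p q. \<kappa> (mul Q (s p) (s q)), vmul = \<lambda>x y. \<kappa> (mul Q (\<iota> x) (\<iota> y)),
     pact = \<lambda>p x. \<kappa> (brk Q (s p) (\<iota> x)), cocyc = \<lambda>p q. \<kappa> (brk Q (s p) (s q)),
     vbrk = \<lambda>x y. \<kappa> (brk Q (\<iota> x) (\<iota> y)) \<rparr>"
  define \<phi> where "\<phi> q = (\<pi> q, \<kappa> q)" for q
  note prod = scl_crossed_product[OF P.vector_space_axioms vector_space_over_itself.vector_space_axioms]
  have \<kappa>_bil: "\<kappa> (h a b) = \<kappa> (h (s (\<pi> a)) (s (\<pi> b))) + \<kappa> (h (s (\<pi> a)) (\<iota> (\<kappa> b)))
      + \<kappa> (h (\<iota> (\<kappa> a)) (s (\<pi> b))) + \<kappa> (h (\<iota> (\<kappa> a)) (\<iota> (\<kappa> b)))"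
    if "bilin (scl Q) (scl Q) (scl Q) h" for h a b
  proof -
    have "\<kappa> (h a b) = \<kappa> (h (s (\<pi> a) + \<iota> (\<kappa> a)) (s (\<pi> b) + \<iota> (\<kappa> b)))" by (simp only: split)
    then show ?thesis using that unfolding bilin_iff by (simp add: \<kappa>_add algebra_simps)
  qed
  have \<kappa>_neg: "\<kappa> (- a) = - \<kappa> a" for a
    using \<kappa>_add[of a "- a"] \<kappa>_add[of 0 0] by (simp add: eq_neg_iff_add_eq_0 add.commute)
  have "\<exists>q. v = \<phi> q" for v
  proof -
    have "\<kappa> (s (fst v) + \<iota> (snd v)) = snd v" by (rule \<kappa>_eq) (simp add: \<pi>.add s \<pi>\<iota>)
    then have "v = \<phi> (s (fst v) + \<iota> (snd v))" by (simp add: \<phi>_def \<pi>.add s \<pi>\<iota>)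
    then show ?thesis by blast
  qed
  then have \<phi>_surj: "surj \<phi>" unfolding surj_def by blast
  have hom_\<phi>: "poisson_hom Q (crossed_product P (*) C) \<phi>"
  proof (rule poisson_hom_surj_image[OF Q])
    show "Vector_Spaces.linear (scl Q) (scl (crossed_product P (*) C)) \<phi>"
      unfolding linear_between_iff
      by (intro conjI allI Q.vector_space_axioms prod(2))
        (simp_all add: prod(1) \<phi>_def \<pi>.add \<pi>.scale \<kappa>_add \<kappa>_scl)
    show "surj \<phi>" by (rule \<phi>_surj)
    show "\<phi> (mul Q x y) = mul (crossed_product P (*) C) (\<phi> x) (\<phi> y)" for x y
      using \<kappa>_bil[OF Q.mul_bilin, of x y]
      by (simp add: crossed_product_def C_def \<phi>_def \<pi>_mul)
    show "\<phi> (brk Q x y) = brk (crossed_product P (*) C) (\<phi> x) (\<phi> y)" for x y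
      using \<kappa>_bil[OF Q.brk_bilin, of x y] Q.brk_anti[of "\<iota> (\<kappa> x)" "s (\<pi> y)"]
      by (simp add: crossed_product_def C_def \<phi>_def \<pi>_brk \<kappa>_neg)
  qed
  note mul_coeff = bilin_compose[OF Q.mul_bilin _ _ \<kappa>_lin]
  note brk_coeff = bilin_compose[OF Q.brk_bilin _ _ \<kappa>_lin]
  have "C \<in> crossed_systems P (*)"
    unfolding crossed_systems_def mem_Collect_eq
  proof (intro conjI)
    show "poisson_algebra (crossed_product P (*) C)" using hom_\<phi> unfolding poisson_hom_def by blast
  qed (simp_all only: C_def crossed.select_convs mul_coeff[OF s_lin s_lin] mul_coeff[OF s_lin \<iota>_lin]
      mul_coeff[OF \<iota>_lin s_lin] mul_coeff[OF \<iota>_lin \<iota>_lin] brk_coeff[OF s_lin s_lin]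
      brk_coeff[OF s_lin \<iota>_lin] brk_coeff[OF \<iota>_lin \<iota>_lin])
  moreover have "bij \<phi>"
  proof -
    have "inj \<phi>"
    proof (rule injI)
      fix a b assume "\<phi> a = \<phi> b"
      then have "\<pi> a = \<pi> b" "\<kappa> a = \<kappa> b" by (simp_all add: \<phi>_def)
      then show "a = b" by (metis split)
    qed
    then show ?thesis using \<phi>_surj by (simp add: bij_def)
  qed
  then have "ext_cohomologous Q \<pi> \<iota> (crossed_product P (*) C) fst (\<lambda>x. (0, x))"
    unfolding ext_cohomologous_def using hom_\<phi>
    by (intro exI[of _ \<phi>]) (simp add: \<phi>_def fun_eq_iff \<pi>\<iota> \<kappa>\<iota>)
  ultimately show ?thesis by (rule that)
qed

section \<open>Cohomology of crossed systems\<close>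

lemma crossed_cohomologous_refl:
  assumes "C \<in> crossed_systems P sV"
  shows "crossed_cohomologous P sV C C"
proof -
  have b: "bilin sV (scl P) sV (ract C)" "bilin (scl P) sV sV (lact C)" "bilin sV sV sV (vmul C)"
     "bilin (scl P) sV sV (pact C)" "bilin sV sV sV (vbrk C)"
    using assms unfolding crossed_systems_def by blast+
  have v: "vector_space sV" "vector_space (scl P)" using b(1) unfolding bilin_iff by blast+
  then have "sV c 0 = 0" for c
    by (metis module.scale_zero_right module_iff_vector_space)
  then have "Vector_Spaces.linear (scl P) sV (\<lambda>_. 0)" using v unfolding linear_between_iff by simp
  then show ?thesis unfolding crossed_cohomologous_def
    using b by (intro conjI exI[of _ "\<lambda>_. 0"]) (simp_all add: bilin_zero)
qed


lemma crossed_systems_bilin: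
  assumes "C \<in> crossed_systems P sV"
  shows "bilin (scl P) sV sV (lact C)" "bilin sV (scl P) sV (ract C)"
    "bilin (scl P) (scl P) sV (theta C)" "bilin sV sV sV (vmul C)"
    "bilin (scl P) sV sV (pact C)" "bilin (scl P) (scl P) sV (cocyc C)" "bilin sV sV sV (vbrk C)"
  using assms unfolding crossed_systems_def by blast+

text \<open>In the bracket of two elements \<open>(0, x)\<close> and \<open>(0, y)\<close> the cocycle and the action vanish.\<close>

lemma vbrk_anti:
  assumes "C \<in> crossed_systems P sV"
  shows "vbrk C x y = - vbrk C y x"
proof -
  interpret poisson_algebra "crossed_product P sV C"
    using assms unfolding crossed_systems_def by blast
  note b = crossed_systems_bilin[OF assms]
  show ?thesis
    using arg_cong[OF brk_anti[of "(0, x)" "(0, y)"], of snd]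
    by (simp add: crossed_product_def split_beta bilin_zero[OF b(5)] bilin_zero[OF b(6)])
qed

text \<open>If \<open>r\<close> carries one system to another and \<open>t\<close> carries that one further, then \<open>- r\<close> and \<open>t + r\<close> are the
  linear maps for the inverse and the composite. In the equation for the cocycle, the mixed brackets
  on \<open>V\<close> cancel only because the bracket is antisymmetric.\<close>

lemma crossed_cohomologous_sym:
  assumes "D \<in> crossed_systems P sV" "crossed_cohomologous P sV C D"
  shows "crossed_cohomologous P sV D C"
proof -
  note b = crossed_systems_bilin[OF assms(1)]
  obtain r where r: "Vector_Spaces.linear (scl P) sV r"
    and e: "vmul C = vmul D" "vbrk C = vbrk D"
        "\<And>p x. lact C p x = lact D p x + vmul D (r p) x"
        "\<And>p x. ract C x p = ract D x p + vmul D x (r p)"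
        "\<And>p q. theta C p q =
           theta D p q + lact D p (r q) + ract D (r p) q - r (mul P p q) + vmul D (r p) (r q)"
        "\<And>p x. pact C p x = pact D p x + vbrk D (r p) x"
        "\<And>p q. cocyc C p q =
           cocyc D p q + pact D p (r q) - pact D q (r p) + vbrk D (r p) (r q) - r (brk P p q)"
    using assms(2) unfolding crossed_cohomologous_def by blast
  interpret r: Vector_Spaces.linear "scl P" sV r by (rule r)
  have "Vector_Spaces.linear (scl P) sV (\<lambda>p. - r p)"
    using r unfolding linear_between_iff by (simp add: r.vs2.scale_minus_right)
  moreover have "cocyc D p q = cocyc C p q + pact C p (- r q) - pact C q (- r p)
      + vbrk C (- r p) (- r q) - (- r (brk P p q))" for p q
    using vbrk_anti[OF assms(1), of "r q" "r p"]
    by (simp add: e b[THEN bilin_minus(1)] b[THEN bilin_minus(2)])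
  ultimately show ?thesis unfolding crossed_cohomologous_def
    by (intro conjI exI[of _ "\<lambda>p. - r p"])
      (simp_all add: e b[THEN bilin_minus(1)] b[THEN bilin_minus(2)])
qed

lemma crossed_cohomologous_trans:
  assumes "D \<in> crossed_systems P sV" "E \<in> crossed_systems P sV"
    "crossed_cohomologous P sV C D" "crossed_cohomologous P sV D E"
  shows "crossed_cohomologous P sV C E"
proof -
  note b = crossed_systems_bilin[OF assms(2), unfolded bilin_iff]
  obtain r where r: "Vector_Spaces.linear (scl P) sV r"
    and e: "vmul C = vmul D" "vbrk C = vbrk D"
        "\<And>p x. lact C p x = lact D p x + vmul D (r p) x"
        "\<And>p x. ract C x p = ract D x p + vmul D x (r p)"
        "\<And>p q. theta C p q =
           theta D p q + lact D p (r q) + ract D (r p) q - r (mul P p q) + vmul D (r p) (r q)"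
        "\<And>p x. pact C p x = pact D p x + vbrk D (r p) x"
        "\<And>p q. cocyc C p q =
           cocyc D p q + pact D p (r q) - pact D q (r p) + vbrk D (r p) (r q) - r (brk P p q)"
    using assms(3) unfolding crossed_cohomologous_def by blast
  obtain t where t: "Vector_Spaces.linear (scl P) sV t"
    and f: "vmul D = vmul E" "vbrk D = vbrk E"
        "\<And>p x. lact D p x = lact E p x + vmul E (t p) x"
        "\<And>p x. ract D x p = ract E x p + vmul E x (t p)"
        "\<And>p q. theta D p q =
           theta E p q + lact E p (t q) + ract E (t p) q - t (mul P p q) + vmul E (t p) (t q)"
        "\<And>p x. pact D p x = pact E p x + vbrk E (t p) x"
        "\<And>p q. cocyc D p q =
           cocyc E p q + pact E p (t q) - pact E q (t p) + vbrk E (t p) (t q) - t (brk P p q)"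
    using assms(4) unfolding crossed_cohomologous_def by blast
  have "Vector_Spaces.linear (scl P) sV (\<lambda>p. t p + r p)"
    using r t unfolding linear_between_iff
    by (auto simp: algebra_simps module.scale_right_distrib module_iff_vector_space)
  moreover have "cocyc C p q = cocyc E p q + pact E p (t q + r q) - pact E q (t p + r p)
      + vbrk E (t p + r p) (t q + r q) - (t (brk P p q) + r (brk P p q))" for p q
    using vbrk_anti[OF assms(2), of "t q" "r p"] b by (simp add: e f)
  ultimately show ?thesis unfolding crossed_cohomologous_def
    using b by (intro conjI exI[of _ "\<lambda>p. t p + r p"]) (simp_all add: e f)
qed

text \<open>The shear \<open>(p, x) \<mapsto> (p, r p + x)\<close> fixes \<open>V\<close> and induces the identity on \<open>P\<close>; the five equations for
  \<open>r\<close> say that it is compatible with product and bracket.\<close>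

lemma ext_cohomologous_crossed_product:
  assumes "C \<in> crossed_systems P sV" "D \<in> crossed_systems P sV" "crossed_cohomologous P sV C D"
  shows "ext_cohomologous (crossed_product P sV C) fst (\<lambda>x. (0, x))
           (crossed_product P sV D) fst (\<lambda>x. (0, x))"
proof -
  note b = crossed_systems_bilin[OF assms(2), unfolded bilin_iff]
  have vs: "vector_space (scl P)" "vector_space sV" using b(1) by blast+
  obtain r where r: "Vector_Spaces.linear (scl P) sV r"
    and e: "vmul C = vmul D" "vbrk C = vbrk D"
        "\<And>p x. lact C p x = lact D p x + vmul D (r p) x"
        "\<And>p x. ract C x p = ract D x p + vmul D x (r p)"
        "\<And>p q. theta C p q =
           theta D p q + lact D p (r q) + ract D (r p) q - r (mul P p q) + vmul D (r p) (r q)"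
        "\<And>p x. pact C p x = pact D p x + vbrk D (r p) x"
        "\<And>p q. cocyc C p q =
           cocyc D p q + pact D p (r q) - pact D q (r p) + vbrk D (r p) (r q) - r (brk P p q)"
    using assms(3) unfolding crossed_cohomologous_def by blast
  interpret r: Vector_Spaces.linear "scl P" sV r by (rule r)
  define \<phi> where "\<phi> v = (fst v, r (fst v) + snd v)" for v
  have "Vector_Spaces.linear (scl (crossed_product P sV C)) (scl (crossed_product P sV D)) \<phi>"
    unfolding linear_between_iff
    using scl_crossed_product[OF vs]
    by (simp add: \<phi>_def r.add r.scale r.vs2.scale_right_distrib)
  moreover have "\<phi> (mul (crossed_product P sV C) v w) = mul (crossed_product P sV D) (\<phi> v) (\<phi> w)"
    and "\<phi> (brk (crossed_product P sV C) v w) = brk (crossed_product P sV D) (\<phi> v) (\<phi> w)" for v w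
    using b vbrk_anti[OF assms(2), of "snd v" "r (fst w)"]
    by (simp_all add: \<phi>_def crossed_product_def split_beta e)
  moreover have "bij \<phi>"
    by (rule bij_betw_byWitness[where f' = "\<lambda>v. (fst v, snd v - r (fst v))"]) (simp_all add: \<phi>_def)
  ultimately show ?thesis
    using assms(1,2) unfolding ext_cohomologous_def poisson_hom_def crossed_systems_def
    by (intro exI[of _ \<phi>]) (simp add: fun_eq_iff \<phi>_def r.zero)
qed

section \<open>Crossed systems with one-dimensional kernel\<close>

lemma bilin_one_dim:
  fixes C :: "('p::ab_group_add, 'k::field) crossed"
  assumes "C \<in> crossed_systems P (*)"
  shows "lact C p x = lact C p 1 * x" "ract C x p = ract C 1 p * x"
    "vmul C x y = vmul C 1 1 * x * y" "pact C p x = pact C p 1 * x" "vbrk C x y = 0"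
proof -
  note b = crossed_systems_bilin[OF assms]
  show "lact C p x = lact C p 1 * x"
    using b(1) unfolding bilin_iff by (metis mult.commute mult.right_neutral)
  show "ract C x p = ract C 1 p * x"
    using b(2) unfolding bilin_iff by (metis mult.commute mult.right_neutral)
  show "vmul C x y = vmul C 1 1 * x * y"
    using b(4) unfolding bilin_iff by (metis mult.commute mult.right_neutral)
  show "pact C p x = pact C p 1 * x"
    using b(5) unfolding bilin_iff by (metis mult.commute mult.right_neutral)
  interpret poisson_algebra "crossed_product P (*) C"
    using assms unfolding crossed_systems_def by blast
  have "vbrk C 1 1 = 0"
    using arg_cong[OF brk_self[of "(0, 1)"], of snd]
    by (simp add: crossed_product_def bilin_zero[OF b(5)] bilin_zero[OF b(6)])
  moreover have "vbrk C x y = x * (y * vbrk C 1 1)"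
    using b(7) unfolding bilin_iff by (metis mult.right_neutral)
  ultimately show "vbrk C x y = 0" by simp
qed

text \<open>A kernel with product \<open>x \<cdot> y = u x y\<close>, where \<open>u\<close> is nonzero, has the unit \<open>1 / u\<close>. Associativity
  therefore forces \<open>p\<close> to act on either side as multiplication by one element \<open>l p / u\<close> of the
  kernel. The corrected section \<open>p \<mapsto> (p, - l p / u)\<close> annihilates the kernel, and its
  image turns out to be a Poisson subalgebra: the extension is the direct product of \<open>P\<close> with the kernel.\<close>

lemma crossed_cohomologous_split:
  fixes C :: "('p::ab_group_add, 'k::field) crossed"
  assumes C: "C \<in> crossed_systems P (*)" and P: "poisson_algebra P" and u: "vmul C 1 1 = u" "u \<noteq> 0"
  shows "crossed_cohomologous P (*) C
    \<lparr>lact = \<lambda>_ _. 0, ract = \<lambda>_ _. 0, theta = \<lambda>_ _. 0, vmul = \<lambda>x y. u * x * y,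
     pact = \<lambda>_ _. 0, cocyc = \<lambda>_ _. 0, vbrk = \<lambda>_ _. 0\<rparr>"
proof -
  note b = crossed_systems_bilin[OF C]
  note zero = b[THEN bilin_zero(1)] b[THEN bilin_zero(2)]
  interpret X: poisson_algebra "crossed_product P (*) C"
    using C unfolding crossed_systems_def by blast
  interpret P: poisson_algebra P by (rule P)
  note one = bilin_one_dim[OF C]
  note P_zero = P.mul_bilin[THEN bilin_zero(1)] P.mul_bilin[THEN bilin_zero(2)]
    P.brk_bilin[THEN bilin_zero(1)] P.brk_bilin[THEN bilin_zero(2)]
  have vmul: "vmul C x y = u * x * y" for x y using one(3) u(1) by simp
  define l where "l p = lact C p 1" for p
  have lact: "lact C p x = l p * x" for p x unfolding l_def by (rule one(1))
  have l_zero: "l 0 = 0" by (simp add: l_def zero)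
  have ract: "ract C x p = l p * x" for p x
  proof -
    have "ract C 1 p = l p"
      using arg_cong[OF X.mul_assoc[of "(0, 1)" "(p, 0)" "(0, 1)"], of snd] u(2)
      by (simp add: crossed_product_def zero P_zero vmul lact l_zero)
    then show ?thesis using one(2)[of x p] by simp
  qed
  have theta: "theta C p q = (l p * l q - l (mul P p q)) / u" for p q
    using arg_cong[OF X.mul_assoc[of "(p, 0)" "(q, 0)" "(0, 1)"], of snd] u(2)
    by (simp add: crossed_product_def zero P_zero vmul lact l_zero field_simps)
  have pact: "pact C p x = 0" for p x
  proof -
    \<comment> \<open>The Leibniz rule for the square of \<open>(0, 1)\<close>, whose two right-hand terms agree.\<close>
    have "pact C p 1 * u = pact C p 1 * u + pact C p 1 * u"
      using arg_cong[OF X.leibniz[of "(0, 1)" "(0, 1)" "(p, 0)"], of snd] one(4)[of p u]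
      by (simp add: crossed_product_def zero P_zero vmul mult.commute[of u]
          del: mult_cancel_left mult_cancel_right)
    then have "pact C p 1 = 0" using u(2) by (metis add_cancel_right_right mult_eq_0_iff)
    then show ?thesis using one(4)[of p x] by simp
  qed
  have cocyc: "cocyc C p q = - l (brk P p q) / u" for p q
    using arg_cong[OF X.leibniz[of "(p, 0)" "(0, 1)" "(q, 0)"], of snd] u(2)
    by (simp add: crossed_product_def zero P_zero vmul lact l_zero pact field_simps eq_neg_iff_add_eq_0)
  have "Vector_Spaces.linear (scl P) (*) (\<lambda>p. l p / u)"
    using b(1) unfolding bilin_iff linear_between_iff l_def by (simp add: add_divide_distrib)
  then show ?thesis
    unfolding crossed_cohomologous_def
    using u(2) by (intro conjI exI[of _ "\<lambda>p. l p / u"])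
      (simp_all add: fun_eq_iff vmul one(5) lact ract theta pact cocyc diff_divide_distrib)
qed

section \<open>Normal forms over \<open>P12\<close>\<close>

text \<open>All normal forms have cocycle \<open>\<vartheta> = 0\<close>, and the actions factor through the first coordinate, because
  \<open>y2\<close> is nilpotent and a commutator. What remains is the left action \<open>a\<close> of \<open>y1\<close>, its right action \<open>b\<close>,
  its bracket action \<open>g\<close>, the product \<open>u\<close> of the kernel and the coefficient \<open>f\<close> of the alternating
  cocycle.\<close>

definition normal_system :: "'k::field \<Rightarrow> 'k \<Rightarrow> 'k \<Rightarrow> 'k \<Rightarrow> 'k \<Rightarrow> ('k ^ 2, 'k) crossed" where
  "normal_system a b g u f =
     \<lparr>lact = \<lambda>p x. a * p $ 1 * x, ract = \<lambda>x p. b * p $ 1 * x, theta = \<lambda>_ _. 0,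
      vmul = \<lambda>x y. u * x * y, pact = \<lambda>p x. g * p $ 1 * x,
      cocyc = \<lambda>p q. f * (p $ 1 * q $ 2 - p $ 2 * q $ 1), vbrk = \<lambda>_ _. 0\<rparr>"

text \<open>The six summands of the index type are the six families of the classification, in the
  order in which the theorem lists them.\<close>

fun normal_form :: "unit + unit + 'k::field + 'k + 'k + 'k \<Rightarrow> ('k ^ 2, 'k) crossed" where
  "normal_form (Inl _) = normal_system 0 0 0 0 0"
| "normal_form (Inr (Inl _)) = normal_system 1 1 0 0 0"
| "normal_form (Inr (Inr (Inl \<nu>))) = normal_system 1 0 1 0 \<nu>"
| "normal_form (Inr (Inr (Inr (Inl \<omega>)))) = normal_system 1 0 \<omega> 0 0"
| "normal_form (Inr (Inr (Inr (Inr (Inl \<tau>))))) = normal_system 0 1 \<tau> 0 0"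
| "normal_form (Inr (Inr (Inr (Inr (Inr u))))) = normal_system 0 0 0 u 0"

fun normal_table :: "unit + unit + 'k::field + 'k + 'k + 'k \<Rightarrow> ('k, 'k ^ 3) palg" where
  "normal_table (Inl _) = k13"
| "normal_table (Inr (Inl _)) = k13_bar"
| "normal_table (Inr (Inr (Inl \<nu>))) = k13_nu \<nu>"
| "normal_table (Inr (Inr (Inr (Inl \<omega>)))) = k13_omega \<omega>"
| "normal_table (Inr (Inr (Inr (Inr (Inl \<tau>))))) = k13_tau \<tau>"
| "normal_table (Inr (Inr (Inr (Inr (Inr u))))) = k13_u u"

lemma P12_simps [simp]:
  "scl P12 = (*s)"
  "mul P12 p q $ 1 = p $ 1 * q $ 1" "mul P12 p q $ 2 = p $ 1 * q $ 2"
  "brk P12 p q $ 1 = 0" "brk P12 p q $ 2 = p $ 1 * q $ 2 - p $ 2 * q $ 1"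
  by (simp_all add: P12_def table_alg_def bas_def axis_def)

lemma bas_simps [simp]:
  "bas (1::2) $ 1 = 1" "bas (1::2) $ 2 = 0" "bas (2::2) $ 1 = 0" "bas (2::2) $ 2 = 1"
  "bas (1::3) $ 1 = 1" "bas (1::3) $ 2 = 0" "bas (1::3) $ 3 = 0"
  "bas (2::3) $ 1 = 0" "bas (2::3) $ 2 = 1" "bas (2::3) $ 3 = 0"
  "bas (3::3) $ 1 = 0" "bas (3::3) $ 2 = 0" "bas (3::3) $ 3 = 1"
  by (simp_all add: bas_def axis_def)

lemma normal_system_bilin:
  "bilin (*s) (*) (*) (lact (normal_system a b g u f))"
  "bilin (*) (*s) (*) (ract (normal_system a b g u f))"
  "bilin (*s) (*s) (*) (theta (normal_system a b g u f))"
  "bilin (*) (*) (*) (vmul (normal_system a b g u f))"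
  "bilin (*s) (*) (*) (pact (normal_system a b g u f))"
  "bilin (*s) (*s) (*) (cocyc (normal_system a b g u f))"
  "bilin (*) (*) (*) (vbrk (normal_system a b g u f))"
  unfolding bilin_iff normal_system_def
  using vec.vector_space_axioms vector_space_over_itself.vector_space_axioms
  by (auto simp: algebra_simps)

text \<open>The map \<open>x \<mapsto> (proj32 x, x $ 3)\<close> carries the algebra \<open>R\<close> on \<open>e1, e2, e3\<close> to the crossed product. Since \<open>R\<close> is
  known to be a Poisson algebra, this also shows that the normal system is a crossed system.\<close>

lemma normal_system_product:
  fixes R :: "('k::field, 'k ^ 3) palg"
  assumes R: "poisson_algebra R" "scl R = (*s)"
    and mul: "\<And>x y. mul R x y = (x $ 1 * y $ 1) *s bas 1 + (x $ 1 * y $ 2) *s bas 2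
      + (a * x $ 1 * y $ 3 + b * x $ 3 * y $ 1 + u * x $ 3 * y $ 3) *s bas 3"
    and brk: "\<And>x y. brk R x y = (x $ 1 * y $ 2 - x $ 2 * y $ 1) *s bas 2
      + (f * (x $ 1 * y $ 2 - x $ 2 * y $ 1) + g * (x $ 1 * y $ 3 - x $ 3 * y $ 1)) *s bas 3"
  shows "normal_system a b g u f \<in> crossed_systems P12 (*)"
    and "ext_cohomologous R proj32 (\<lambda>c. c *s bas 3)
      (crossed_product P12 (*) (normal_system a b g u f)) fst (\<lambda>x. (0, x))"
proof -
  let ?N = "normal_system a b g u f"
  let ?X = "crossed_product P12 (*) ?N"
  define \<phi> :: "'k ^ 3 \<Rightarrow> ('k ^ 2) \<times> 'k" where "\<phi> x = (proj32 x, (x $ 3))" for x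
  have vs: "vector_space (scl (P12 :: ('k, 'k ^ 2) palg))" "vector_space ((*) :: 'k \<Rightarrow> 'k \<Rightarrow> 'k)"
    by (simp_all add: vec.vector_space_axioms vector_space_over_itself.vector_space_axioms)
  have bij: "bij \<phi>"
    by (rule bij_betw_byWitness[where f' = "\<lambda>v. fst v $ 1 *s bas 1 + fst v $ 2 *s bas 2 + snd v *s bas 3"])
      (auto simp: \<phi>_def proj32_def vec_eq_iff forall_2 forall_3)
  have hom: "poisson_hom R ?X \<phi>"
  proof (rule poisson_hom_surj_image[OF R(1)])
    show "Vector_Spaces.linear (scl R) (scl ?X) \<phi>"
      unfolding linear_between_iff
      using scl_crossed_product[OF vs] vec.vector_space_axioms[where 'a = 'k and 'b = 3]
      by (simp add: R(2) \<phi>_def proj32_def vec_eq_iff forall_2 algebra_simps)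
    show "surj \<phi>" using bij by (rule bij_is_surj)
    show "\<phi> (mul R x y) = mul ?X (\<phi> x) (\<phi> y)" for x y
      by (simp add: \<phi>_def mul crossed_product_def normal_system_def proj32_def vec_eq_iff forall_2)
    show "\<phi> (brk R x y) = brk ?X (\<phi> x) (\<phi> y)" for x y
      by (simp add: \<phi>_def brk crossed_product_def normal_system_def proj32_def vec_eq_iff forall_2
          algebra_simps)
  qed
  then show "?N \<in> crossed_systems P12 (*)"
    unfolding crossed_systems_def poisson_hom_def by (simp add: normal_system_bilin)
  show "ext_cohomologous R proj32 (\<lambda>c. c *s bas 3) ?X fst (\<lambda>x. (0, x))"
    unfolding ext_cohomologous_def using hom bij
    by (intro exI[of _ \<phi>]) (simp add: fun_eq_iff \<phi>_def proj32_def vec_eq_iff forall_2)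
qed

lemma normal_form_product:
  "normal_form i \<in> crossed_systems P12 (*) \<and>
   ext_cohomologous (normal_table i) proj32 (\<lambda>c. c *s bas 3)
     (crossed_product P12 (*) (normal_form i)) fst (\<lambda>x. (0, x))"
proof (cases i rule: normal_form.cases)
  case 1
  show ?thesis unfolding 1 normal_form.simps normal_table.simps
    by (intro conjI normal_system_product[OF poisson_k13(1)])
      (simp_all add: k13_def table_alg_def vec_eq_iff forall_3)
next
  case 2
  show ?thesis unfolding 2 normal_form.simps normal_table.simps
    by (intro conjI normal_system_product[OF poisson_k13(2)])
      (simp_all add: k13_bar_def table_alg_def vec_eq_iff forall_3)
next
  case (3 \<nu>)
  show ?thesis unfolding 3 normal_form.simps normal_table.simps
    by (intro conjI normal_system_product[OF poisson_k13(3)[of \<nu>]])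
      (simp_all add: k13_nu_def table_alg_def vec_eq_iff forall_3 algebra_simps)
next
  case (4 \<omega>)
  show ?thesis unfolding 4 normal_form.simps normal_table.simps
    by (intro conjI normal_system_product[OF poisson_k13(4)[of \<omega>]])
      (simp_all add: k13_omega_def table_alg_def vec_eq_iff forall_3 algebra_simps)
next
  case (5 \<tau>)
  show ?thesis unfolding 5 normal_form.simps normal_table.simps
    by (intro conjI normal_system_product[OF poisson_k13(5)[of \<tau>]])
      (simp_all add: k13_tau_def table_alg_def vec_eq_iff forall_3 algebra_simps)
next
  case (6 u)
  show ?thesis unfolding 6 normal_form.simps normal_table.simps
    by (intro conjI normal_system_product[OF poisson_k13(6)[of u]])
      (simp_all add: k13_u_def table_alg_def vec_eq_iff forall_3 algebra_simps)
qed

text \<open>The value \<open>\<omega> = 1\<close> is left out since it gives the same system as \<open>\<nu> = 0\<close>, and \<open>u = 0\<close> since it gives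
  the system of the first family.\<close>

abbreviation (input) parameters :: "(unit + unit + 'k::field + 'k + 'k + 'k) set" where
  "parameters \<equiv> {()} <+> {()} <+> UNIV <+> (UNIV - {1}) <+> UNIV <+> (UNIV - {0})"

text \<open>A shear leaves the bracket action alone, changes the left and right actions by multiples of \<open>u\<close>, and
  changes the value of the cocycle at
  \<open>(y1, y2)\<close> by \<open>(g' - 1) r(y2)\<close>. So the product of the kernel is always an invariant, the actions are
  invariants when this product vanishes, and \<open>f\<close> is an invariant when \<open>g' = 1\<close>.\<close>

lemma normal_system_invariants:
  fixes a b g u f :: "'k::field"
  assumes "crossed_cohomologous P12 (*) (normal_system a b g u f) (normal_system a' b' g' u' f')"
  shows "u = u' \<and> (u' = 0 \<longrightarrow> a = a' \<and> b = b' \<and> g = g') \<and> (g' = 1 \<longrightarrow> f = f')"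
proof -
  let ?N = "normal_system a b g u f" and ?N' = "normal_system a' b' g' u' f'"
  obtain r where vmul: "vmul ?N = vmul ?N'"
    and lact: "\<forall>p x. lact ?N p x = lact ?N' p x + vmul ?N' (r p) x"
    and ract: "\<forall>p x. ract ?N x p = ract ?N' x p + vmul ?N' x (r p)"
    and pact: "\<forall>p x. pact ?N p x = pact ?N' p x + vbrk ?N' (r p) x"
    and cocyc: "\<forall>p q. cocyc ?N p q = cocyc ?N' p q + pact ?N' p (r q)
       - pact ?N' q (r p) + vbrk ?N' (r p) (r q) - r (brk P12 p q)"
    using assms unfolding crossed_cohomologous_def by blast
  have brk: "brk P12 (bas 1) (bas 2) = (bas 2 :: 'k ^ 2)" by (simp add: vec_eq_iff forall_2)
  have "u = u'" using fun_cong[OF fun_cong[OF vmul, of 1], of 1] by (simp add: normal_system_def)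
  moreover have "a = a' \<and> b = b' \<and> g = g'" if "u' = 0"
    using lact[rule_format, of "bas 1" 1] ract[rule_format, of 1 "bas 1"]
      pact[rule_format, of "bas 1" 1] that by (simp add: normal_system_def)
  moreover have "f = f'" if "g' = 1"
    using cocyc[rule_format, of "bas 1" "bas 2"] that by (simp add: normal_system_def brk)
  ultimately show ?thesis by blast
qed

lemma normal_form_inj:
  assumes "i \<in> parameters" "j \<in> parameters"
    and "crossed_cohomologous P12 (*) (normal_form i) (normal_form j)"
  shows "i = j"
  using assms
  by (cases i rule: normal_form.cases; cases j rule: normal_form.cases)
    (simp_all only: normal_form.simps, (drule normal_system_invariants, auto)+)

section \<open>Reduction to normal form\<close>

lemma vec2_expand: "p = p $ 1 *s bas 1 + p $ 2 *s (bas 2 :: 'k::field ^ 2)"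
  by (simp add: vec_eq_iff forall_2)

lemma linear_vec2:
  fixes h :: "'k::field ^ 2 \<Rightarrow> 'k"
  assumes "Vector_Spaces.linear (*s) (*) h"
  shows "h p = h (bas 1) * p $ 1 + h (bas 2) * p $ 2"
proof -
  have "h p = h (p $ 1 *s bas 1 + p $ 2 *s bas 2)" by (simp only: vec2_expand[symmetric])
  then show ?thesis using assms unfolding linear_between_iff by simp
qed

lemma bilin_vec2:
  fixes h :: "'k::field ^ 2 \<Rightarrow> 'k ^ 2 \<Rightarrow> 'k"
  assumes "bilin (*s) (*s) (*) h"
  shows "h p q = h (bas 1) (bas 1) * p $ 1 * q $ 1 + h (bas 1) (bas 2) * p $ 1 * q $ 2
    + h (bas 2) (bas 1) * p $ 2 * q $ 1 + h (bas 2) (bas 2) * p $ 2 * q $ 2"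
proof -
  have l: "Vector_Spaces.linear (*s) (*) (h a)" "Vector_Spaces.linear (*s) (*) (\<lambda>p. h p a)" for a
    using assms unfolding bilin_def by blast+
  show ?thesis
    using linear_vec2[OF l(1), of p q] linear_vec2[OF l(2), of p "bas 1"] linear_vec2[OF l(2), of p "bas 2"]
    by (simp add: algebra_simps)
qed

text \<open>When the kernel has zero product, shears do not change the actions, and associativity makes the left
  and right actions characters of \<open>P12\<close>: zero or one on \<open>y1\<close> and zero on \<open>y2\<close>. The Leibniz rule for
  \<open>y1 \<star> y1\<close> forces \<open>g1 = 0\<close> unless exactly one of the two is the zero character. In
  each of the four cases the associative cocycle is a coboundary; it vanishes outright when only the left
  action is nonzero. After removing it, the Leibniz rule kills the bracket cocycle except in that same
  case, where its value \<open>f12\<close> is free and a shear changes it by multiples of \<open>g1 - 1\<close>. Hence \<open>f12\<close> survives as the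
  parameter \<open>\<nu>\<close> if \<open>g1 = 1\<close>, and otherwise can be removed, leaving the parameter \<open>\<omega> = g1\<close>.\<close>

lemma crossed_cohomologous_square_zero:
  fixes C :: "('k::field ^ 2, 'k) crossed"
  assumes C: "C \<in> crossed_systems P12 (*)" and u: "vmul C 1 1 = 0"
  obtains i where "i \<in> parameters" "crossed_cohomologous P12 (*) C (normal_form i)"
proof -
  note bil = crossed_systems_bilin[OF C]
  interpret X: poisson_algebra "crossed_product P12 (*) C"
    using C unfolding crossed_systems_def by blast
  note one = bilin_one_dim[OF C]
  define a1 a2 b1 b2 g1 g2 where "a1 = lact C (bas 1) 1" and "a2 = lact C (bas 2) 1"
    and "b1 = ract C 1 (bas 1)" and "b2 = ract C 1 (bas 2)"
    and "g1 = pact C (bas 1) 1" and "g2 = pact C (bas 2) 1"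
  define t11 t12 t21 t22 f12 where "t11 = theta C (bas 1) (bas 1)" and "t12 = theta C (bas 1) (bas 2)"
    and "t21 = theta C (bas 2) (bas 1)" and "t22 = theta C (bas 2) (bas 2)"
    and "f12 = cocyc C (bas 1) (bas 2)"
  have vmul: "vmul C x y = 0" for x y using one(3) u by simp
  have lact: "lact C p x = (a1 * p $ 1 + a2 * p $ 2) * x" for p x
    using linear_vec2[of "\<lambda>p. lact C p 1" p] bil(1) one(1)[of p x]
    by (simp add: bilin_def a1_def a2_def)
  have ract: "ract C x p = (b1 * p $ 1 + b2 * p $ 2) * x" for p x
    using linear_vec2[of "\<lambda>p. ract C 1 p" p] bil(2) one(2)[of x p]
    by (simp add: bilin_def b1_def b2_def)
  have pact: "pact C p x = (g1 * p $ 1 + g2 * p $ 2) * x" for p x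
    using linear_vec2[of "\<lambda>p. pact C p 1" p] bil(5) one(4)[of p x]
    by (simp add: bilin_def g1_def g2_def)
  have theta: "theta C p q = t11 * p $ 1 * q $ 1 + t12 * p $ 1 * q $ 2 + t21 * p $ 2 * q $ 1
      + t22 * p $ 2 * q $ 2" for p q
    using bilin_vec2[of "theta C" p q] bil(3) by (simp add: t11_def t12_def t21_def t22_def)
  have cocyc_anti: "cocyc C p q = - cocyc C q p" "cocyc C p p = 0" for p q
    using arg_cong[OF X.brk_anti[of "(p, 0)" "(q, 0)"], of snd]
      arg_cong[OF X.brk_self[of "(p, 0)"], of snd]
    by (simp_all add: crossed_product_def pact one(5))
  have cocyc: "cocyc C p q = f12 * (p $ 1 * q $ 2 - p $ 2 * q $ 1)" for p q
    using bilin_vec2[of "cocyc C" p q] bil(6) cocyc_anti(1)[of "bas 2" "bas 1"]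
    by (simp add: f12_def cocyc_anti(2) algebra_simps)
  note ops = crossed_product_def lact ract pact theta cocyc vmul one(5)
  note asc = arg_cong[OF X.mul_assoc, of snd]
  note lei = arg_cong[OF X.leibniz, of snd]
  note jac = arg_cong[OF X.jacobi, of snd]
  have a: "a2 = 0" "a1 = 0 \<or> a1 = 1"
    using asc[of "(bas 2, 0)" "(bas 2, 0)" "(0, 1)"] asc[of "(bas 1, 0)" "(bas 1, 0)" "(0, 1)"]
    by (simp_all add: ops)
  have b: "b2 = 0" "b1 = 0 \<or> b1 = 1"
    using asc[of "(0, 1)" "(bas 2, 0)" "(bas 2, 0)"] asc[of "(0, 1)" "(bas 1, 0)" "(bas 1, 0)"]
    by (simp_all add: ops)
  have g: "g2 = 0" "g1 = g1 * b1 + a1 * g1"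
    using jac[of "(bas 1, 0)" "(bas 2, 0)" "(0, 1)"] lei[of "(bas 1, 0)" "(bas 1, 0)" "(0, 1)"]
    by (simp_all add: ops algebra_simps)
  \<comment> \<open>The cancellation rules would turn these equations into disjunctions.\<close>
  have t: "t22 = 0" "b1 * t11 = a1 * t11" "a1 * t12 = 0" "t21 + b1 * t12 = a1 * t21" "b1 * t21 = t21"
    using asc[of "(bas 2, 0)" "(bas 1, 0)" "(bas 2, 0)"]
      asc[of "(bas 1, 0)" "(bas 1, 0)" "(bas 1, 0)"]
      asc[of "(bas 1, 0)" "(bas 1, 0)" "(bas 2, 0)"]
      asc[of "(bas 1, 0)" "(bas 2, 0)" "(bas 1, 0)"]
      asc[of "(bas 2, 0)" "(bas 1, 0)" "(bas 1, 0)"]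
    by (simp_all add: ops a(1) b(1) g(1)
        del: mult_cancel_left mult_cancel_right mult_cancel_left1 mult_cancel_left2
          mult_cancel_right1 mult_cancel_right2)
  have f: "f12 = t21 + b1 * f12 + t12 + a1 * f12" "g1 * t12 + f12 = t12 + a1 * f12"
    using lei[of "(bas 1, 0)" "(bas 1, 0)" "(bas 2, 0)"] lei[of "(bas 1, 0)" "(bas 2, 0)" "(bas 1, 0)"]
    by (simp_all add: ops a(1) b(1) g(1) algebra_simps
        del: mult_cancel_left mult_cancel_right mult_cancel_left1 mult_cancel_left2
          mult_cancel_right1 mult_cancel_right2)
  \<comment> \<open>With square-zero kernel, the shear with \<open>y1 \<mapsto> r1\<close>, \<open>y2 \<mapsto> r2\<close> leaves four equations to be solved for
    \<open>r1\<close>, \<open>r2\<close> and \<open>f\<close>.\<close>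
  have coh: "crossed_cohomologous P12 (*) C (normal_system a1 b1 g1 0 f)"
    if "t11 = a1 * r1 + b1 * r1 - r1" "t12 = a1 * r2 - r2" "t21 = b1 * r2" "f12 = f + g1 * r2 - r2"
    for r1 r2 f
  proof -
    have "Vector_Spaces.linear (scl P12) (*) (\<lambda>p :: 'k ^ 2. r1 * p $ 1 + r2 * p $ 2)"
      unfolding linear_between_iff
      by (simp add: vec.vector_space_axioms vector_space_over_itself.vector_space_axioms algebra_simps)
    then show ?thesis unfolding crossed_cohomologous_def
      by (intro conjI exI[of _ "\<lambda>p. r1 * p $ 1 + r2 * p $ 2"])
        (simp_all add: that fun_eq_iff normal_system_def lact ract pact theta cocyc vmul one(5) a(1) b(1) g(1) t(1) algebra_simps)
  qed
  from a(2) b(2) show ?thesis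
  proof (elim disjE)
    assume "a1 = 0" "b1 = 0"
    then show ?thesis
      using coh[of "- t11" "- t12" 0] g(2) t f by (intro that[of "Inl ()"]) auto
  next
    assume ab: "a1 = 0" "b1 = 1"
    then have "t12 = - t21" using t(4) by (simp add: eq_neg_iff_add_eq_0 add.commute)
    then show ?thesis
      using ab coh[of 0 t21 0] g(2) t f by (intro that[of "Inr (Inr (Inr (Inr (Inl g1))))"]) (auto simp: algebra_simps)
  next
    assume ab: "a1 = 1" "b1 = 0"
    show ?thesis
    proof (cases "g1 = 1")
      case True
      then show ?thesis
        using ab coh[of 0 0 f12] g(2) t f by (intro that[of "Inr (Inr (Inl f12))"]) (auto simp: algebra_simps)
    next
      case False
      define r2 where "r2 = f12 / (g1 - 1)"
      have "f12 = r2 * (g1 - 1)" using False by (simp add: r2_def)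
      then have "f12 = g1 * r2 - r2" by (simp add: algebra_simps)
      then show ?thesis
        using False ab coh[of 0 r2 0] g(2) t f
        by (intro that[of "Inr (Inr (Inr (Inl g1)))"]) auto
    qed
  next
    assume ab: "a1 = 1" "b1 = 1"
    \<comment> \<open>Here \<open>g1 = g1 + g1\<close>, which gives \<open>g1 = 0\<close> in every characteristic.\<close>
    then have "g1 = 0" using g(2) by (metis add_cancel_right_right mult_1 mult_1_right)
    moreover have "f12 = - t21" using ab t(3) f(2) \<open>g1 = 0\<close> f(1)
      by (simp add: eq_neg_iff_add_eq_0 add.commute)
    ultimately show ?thesis
      using ab coh[of t11 t21 0] t by (intro that[of "Inr (Inl ())"]) auto
  qed
qed

lemma crossed_cohomologous_normal_form:
  fixes C :: "('k::field ^ 2, 'k) crossed"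
  assumes "C \<in> crossed_systems P12 (*)"
  obtains i where "i \<in> parameters" "crossed_cohomologous P12 (*) C (normal_form i)"
proof (cases "vmul C 1 1 = 0")
  case True
  then show ?thesis using crossed_cohomologous_square_zero[OF assms] that by blast
next
  case False
  then show ?thesis
    using crossed_cohomologous_split[OF assms poisson_P12 refl]
    by (intro that[of "Inr (Inr (Inr (Inr (Inr (vmul C 1 1)))))"]) (auto simp: normal_system_def)
qed

section \<open>The classification\<close>

lemma GPH2_bij:
  "bij_betw (\<lambda>i. {(C, D). C \<in> crossed_systems P12 (*) \<and> D \<in> crossed_systems P12 (*)
      \<and> crossed_cohomologous P12 (*) C D} `` {normal_form i})
    parameters (GPH2 (P12 :: ('k::field, 'k ^ 2) palg) (*))"
proof -
  define S where "S = crossed_systems (P12 :: ('k, 'k ^ 2) palg) (*)"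
  define R where "R = {(C, D). C \<in> S \<and> D \<in> S \<and> crossed_cohomologous (P12 :: ('k, 'k ^ 2) palg) (*) C D}"
  have "equiv S R"
  proof (rule equivI)
    show "R \<subseteq> S \<times> S" by (auto simp: R_def)
    show "refl_on S R" by (auto simp: R_def S_def refl_on_def crossed_cohomologous_refl)
    show "sym R"
      by (rule symI) (simp add: R_def S_def crossed_cohomologous_sym)
    show "trans R"
    proof (rule transI)
      fix C D E assume "(C, D) \<in> R" "(D, E) \<in> R"
      then show "(C, E) \<in> R"
        using crossed_cohomologous_trans[of D P12 "(*)" E C] by (simp add: R_def S_def)
    qed
  qed
  have nf: "normal_form i \<in> S" for i using normal_form_product S_def by blast
  have "bij_betw (\<lambda>i. R `` {normal_form i}) parameters (S // R)"
    unfolding bij_betw_def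
  proof
    show "inj_on (\<lambda>i. R `` {normal_form i}) parameters"
    proof (rule inj_onI)
      fix i j :: "unit + unit + 'k + 'k + 'k + 'k"
      assume ij: "i \<in> parameters" "j \<in> parameters"
        and "R `` {normal_form i} = R `` {normal_form j}"
      then have "(normal_form i, normal_form j) \<in> R"
        using eq_equiv_class[OF _ \<open>equiv S R\<close> nf] by simp
      then show "i = j" using normal_form_inj[OF ij] by (simp add: R_def)
    qed
    show "(\<lambda>i. R `` {normal_form i}) ` parameters = S // R"
    proof
      show "(\<lambda>i. R `` {normal_form i}) ` parameters \<subseteq> S // R"
        using nf by (auto intro: quotientI)
      show "S // R \<subseteq> (\<lambda>i. R `` {normal_form i}) ` parameters"
      proof
        fix X assume "X \<in> S // R"
        then obtain C where C: "C \<in> S" "X = R `` {C}" by (rule quotientE)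
        obtain i where i: "i \<in> parameters" "crossed_cohomologous P12 (*) C (normal_form i)"
          using crossed_cohomologous_normal_form[OF C(1)[unfolded S_def]] .
        then have "(C, normal_form i) \<in> R" using C(1) nf by (simp add: R_def)
        then have "X = R `` {normal_form i}" using C(2) equiv_class_eq[OF \<open>equiv S R\<close>] by simp
        then show "X \<in> (\<lambda>i. R `` {normal_form i}) ` parameters" using i(1) by blast
      qed
    qed
  qed
  then show ?thesis unfolding R_def S_def GPH2_def .
qed

lemma extension_cohomologous_to_table:
  fixes Q :: "('k::field, 'q::ab_group_add) palg"
  assumes "coflag_step Q P12 \<pi>" "kernel_ident Q \<pi> \<iota>"
  obtains i where "i \<in> parameters" "cohomologous_to Q \<pi> \<iota> (normal_table i)"
proof -
  obtain C where C: "C \<in> crossed_systems P12 (*)"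
      "ext_cohomologous Q \<pi> \<iota> (crossed_product P12 (*) C) fst (\<lambda>x. (0, x))"
    using extension_is_crossed_product assms unfolding coflag_step_def by blast
  obtain i where i: "i \<in> parameters" "crossed_cohomologous P12 (*) C (normal_form i)"
    using crossed_cohomologous_normal_form[OF C(1)] .
  note N = normal_form_product[of i]
  have "ext_cohomologous Q \<pi> \<iota> (normal_table i) proj32 (\<lambda>c. c *s bas 3)"
    using ext_cohomologous_trans[OF ext_cohomologous_trans[OF C(2)
          ext_cohomologous_crossed_product[OF C(1) conjunct1[OF N] i(2)]]
        ext_cohomologous_sym[OF conjunct2[OF N]]] .
  then show ?thesis using that[OF i(1)] by (simp add: cohomologous_to_def)
qed

theorem corollary3p9:
  shows "(\<forall>(Q :: ('k::field, 'q::ab_group_add) palg) (\<pi> :: 'q \<Rightarrow> 'k ^ 2) (\<iota> :: 'k \<Rightarrow> 'q).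
            poisson_algebra Q \<and> vector_space.dim (scl Q) UNIV = 3 \<and>
            coflag_step Q P12 \<pi> \<and> kernel_ident Q \<pi> \<iota> \<longrightarrow>
              cohomologous_to Q \<pi> \<iota> k13 \<or>
              cohomologous_to Q \<pi> \<iota> k13_bar \<or>
              (\<exists>\<nu>. cohomologous_to Q \<pi> \<iota> (k13_nu \<nu>)) \<or>
              (\<exists>\<omega>. \<omega> \<in> UNIV - {1} \<and> cohomologous_to Q \<pi> \<iota> (k13_omega \<omega>)) \<or>
              (\<exists>\<tau>. cohomologous_to Q \<pi> \<iota> (k13_tau \<tau>)) \<or>
              (\<exists>u. u \<in> UNIV - {0} \<and> cohomologous_to Q \<pi> \<iota> (k13_u u)))
         \<and>
         (\<exists>h. bij_betw h
            (GPH2 (P12 :: ('k, 'k ^ 2) palg) ((*) :: 'k \<Rightarrow> 'k \<Rightarrow> 'k))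
            ({()} <+> {()} <+> (UNIV :: 'k set) <+> (UNIV - {1} :: 'k set)
              <+> (UNIV :: 'k set) <+> (UNIV - {0} :: 'k set)))"
proof (intro conjI allI impI)
  fix Q :: "('k, 'q) palg" and \<pi> :: "'q \<Rightarrow> 'k ^ 2" and \<iota> :: "'k \<Rightarrow> 'q"
  assume "poisson_algebra Q \<and> vector_space.dim (scl Q) UNIV = 3 \<and>
            coflag_step Q P12 \<pi> \<and> kernel_ident Q \<pi> \<iota>"
  then have step: "coflag_step Q P12 \<pi>" and ker: "kernel_ident Q \<pi> \<iota>" by blast+
  obtain i :: "unit + unit + 'k + 'k + 'k + 'k"
    where "i \<in> parameters" "cohomologous_to Q \<pi> \<iota> (normal_table i)"
    using extension_cohomologous_to_table[OF step ker] .
  then show "cohomologous_to Q \<pi> \<iota> k13 \<or>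
              cohomologous_to Q \<pi> \<iota> k13_bar \<or>
              (\<exists>\<nu>. cohomologous_to Q \<pi> \<iota> (k13_nu \<nu>)) \<or>
              (\<exists>\<omega>. \<omega> \<in> UNIV - {1} \<and> cohomologous_to Q \<pi> \<iota> (k13_omega \<omega>)) \<or>
              (\<exists>\<tau>. cohomologous_to Q \<pi> \<iota> (k13_tau \<tau>)) \<or>
              (\<exists>u. u \<in> UNIV - {0} \<and> cohomologous_to Q \<pi> \<iota> (k13_u u))"
    by (cases i rule: normal_table.cases) auto
qed (rule exI, rule bij_betw_inv_into, rule GPH2_bij)

end
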